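(* For each $n\ge 1$, the sequence of Mahonian numbers of type $B$, $(i_B(n,k))_{0\le k\le n^2}$, is log-concave in $k$, and therefore unimodal.
   Context: $B_n$ is the hyperoctahedral group: the group of bijections $\pi$ of $\{-n,\ldots,-1,1,\ldots,n\}$ with $\pi(-j)=-\pi(j)$ for all $j\in\{1,\dots,n\}$. Every $\pi\in B_n$ is written uniquely as $\pi(p)=(-1)^{r_p}\sigma_p$ for $1\le p\le n$, with $r_p\in\{0,1\}$ and $\sigma=\sigma_1\cdots\sigma_n$ a permutation of $\{1,\dots,n\}$. For $1\le i\le n$ put $m=n+1-i$ and $inv_i(\sigma)=|\{j: j<m,\ \sigma_j>\sigma_m\}|$, and define $inv_i(\pi)=inv_i(\sigma)$ if $r_m=0$, and $inv_i(\pi)=1+2|\{j: j<m,\ \sigma_j<\sigma_m\}|+inv_i(\sigma)$ if $r_m=1$. The number of inversions of type $B$ of $\pi$ is $inv_B(\pi)=\sum_{i=1}^n inv_i(\pi)$. The Mahonian number of type $B$ is $i_B(n,k)=|\{\pi\in B_n: inv_B(\pi)=k\}|$. A sequence $(x_k)_k$ of nonnegative numbers is log-concave if $x_{i-1}x_{i+1}\le x_i^2$ for all $i>0$ (terms beyond the end of a finite sequence being $0$). A finite real sequence $(a_0,\dots,a_m)$ is unimodal if there is an index $0\le m^*\le m$ with $a_0\le a_1\le\cdots\le a_{m^*}\ge a_{m^*+1}\ge\cdots\ge a_m$. *)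

theory Defs
  imports Complex_Main "HOL-Combinatorics.Permutations"
begin

text \<open>
  The predicate \<open>permutes\<close> requires the map to be the identity off the given set, so each signed
  permutation of \<open>{-n, ..., -1, 1, ..., n}\<close> is represented by exactly one function on the integers.
\<close>

definition hyperoctahedral :: "nat \<Rightarrow> (int \<Rightarrow> int) set" where
  "hyperoctahedral n =
     {\<pi>. \<pi> permutes ({- int n..int n} - {0}) \<and> (\<forall>j\<in>{1..int n}. \<pi> (- j) = - \<pi> j)}"

text \<open>
  The sign exponents \<open>r\<close> and the underlying permutation \<open>\<sigma>\<close> of a signed permutation \<open>\<pi>\<close>.  The lemmas
  \<open>hyperoctahedral_decomposition\<close> and \<open>hyperoctahedral_decomposition_unique\<close> below state that
  they are the components of its unique decomposition \<open>\<pi> p = (-1) ^ r p * \<sigma> p\<close>.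
\<close>

definition sign_exp :: "(int \<Rightarrow> int) \<Rightarrow> nat \<Rightarrow> nat" where
  "sign_exp \<pi> p = (if \<pi> (int p) < 0 then 1 else 0)"

definition abs_perm :: "(int \<Rightarrow> int) \<Rightarrow> nat \<Rightarrow> nat" where
  "abs_perm \<pi> p = nat \<bar>\<pi> (int p)\<bar>"

lemma hyperoctahedral_decomposition:
  assumes "\<pi> \<in> hyperoctahedral n"
  shows "\<pi> (int p) = (-1) ^ sign_exp \<pi> p * int (abs_perm \<pi> p)"
    and "sign_exp \<pi> p \<in> {0, 1}"
    and "bij_betw (abs_perm \<pi>) {1..n} {1..n}"
proof -
  show "\<pi> (int p) = (-1) ^ sign_exp \<pi> p * int (abs_perm \<pi> p)" "sign_exp \<pi> p \<in> {0, 1}"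
    by (auto simp: sign_exp_def abs_perm_def)
  have perm: "\<pi> permutes ({- int n..int n} - {0})"
    and odd: "\<And>j. j \<in> {1..int n} \<Longrightarrow> \<pi> (- j) = - \<pi> j"
    using assms by (auto simp: hyperoctahedral_def)
  have "inj_on (abs_perm \<pi>) {1..n}"
  proof (rule inj_onI)
    fix p q assume pq: "p \<in> {1..n}" "q \<in> {1..n}" and eq: "abs_perm \<pi> p = abs_perm \<pi> q"
    from eq have "\<pi> (int p) = \<pi> (int q) \<or> \<pi> (int p) = - \<pi> (int q)"
      by (auto simp: abs_perm_def)
    then have "\<pi> (int p) = \<pi> (int q) \<or> \<pi> (int p) = \<pi> (- int q)"
      using odd[of "int q"] pq by simp
    then have "int p = int q \<or> int p = - int q"
      using inj_eq[OF permutes_inj[OF perm]] by blast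
    then show "p = q" using pq by (elim disjE) simp_all
  qed
  moreover have "abs_perm \<pi> ` {1..n} \<subseteq> {1..n}"
  proof
    fix y assume "y \<in> abs_perm \<pi> ` {1..n}"
    then obtain p where p: "p \<in> {1..n}" "y = abs_perm \<pi> p" by auto
    have "\<pi> (int p) \<in> {- int n..int n} - {0}"
      using permutes_in_image[OF perm, of "int p"] p by auto
    then show "y \<in> {1..n}" using p by (auto simp: abs_perm_def)
  qed
  ultimately show "bij_betw (abs_perm \<pi>) {1..n} {1..n}"
    unfolding bij_betw_def using endo_inj_surj[OF finite_atLeastAtMost] by blast
qed

lemma hyperoctahedral_decomposition_unique:
  fixes r \<sigma> :: "nat \<Rightarrow> nat"
  assumes "bij_betw \<sigma> {1..n} {1..n}" and "p \<in> {1..n}" and "r p \<in> {0, 1}"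
    and "\<pi> (int p) = (-1) ^ r p * int (\<sigma> p)"
  shows "r p = sign_exp \<pi> p" and "\<sigma> p = abs_perm \<pi> p"
proof -
  have "\<sigma> p \<in> {1..n}" using assms(1,2) by (rule bij_betwE[THEN bspec])
  then show "r p = sign_exp \<pi> p" and "\<sigma> p = abs_perm \<pi> p"
    using assms(3,4) by (auto simp: sign_exp_def abs_perm_def)
qed

definition inv_perm :: "nat \<Rightarrow> (nat \<Rightarrow> nat) \<Rightarrow> nat \<Rightarrow> nat" where
  "inv_perm n \<sigma> i = (let m = n + 1 - i in card {j. 1 \<le> j \<and> j < m \<and> \<sigma> j > \<sigma> m})"

definition inv_signed :: "nat \<Rightarrow> (int \<Rightarrow> int) \<Rightarrow> nat \<Rightarrow> nat" where
  "inv_signed n \<pi> i =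
     (let m = n + 1 - i; \<sigma> = abs_perm \<pi> in
      if sign_exp \<pi> m = 0 then inv_perm n \<sigma> i
      else 1 + 2 * card {j. 1 \<le> j \<and> j < m \<and> \<sigma> j < \<sigma> m} + inv_perm n \<sigma> i)"

definition inv_B :: "nat \<Rightarrow> (int \<Rightarrow> int) \<Rightarrow> nat" where
  "inv_B n \<pi> = (\<Sum>i=1..n. inv_signed n \<pi> i)"

definition mahonian_B :: "nat \<Rightarrow> nat \<Rightarrow> nat" where
  "mahonian_B n k = card {\<pi> \<in> hyperoctahedral n. inv_B n \<pi> = k}"

definition log_concave :: "(nat \<Rightarrow> real) \<Rightarrow> bool" where
  "log_concave x \<longleftrightarrow> (\<forall>i. 0 \<le> x i) \<and> (\<forall>i>0. x (i - 1) * x (i + 1) \<le> (x i)\<^sup>2)"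

text \<open>
  A finite sequence \<open>(a 0, ..., a N)\<close> is given by its last index \<open>N\<close> and a function \<open>a\<close> whose values
  beyond \<open>N\<close> are ignored; for log-concavity it is continued by zeros.
\<close>

definition zero_extend :: "nat \<Rightarrow> (nat \<Rightarrow> real) \<Rightarrow> nat \<Rightarrow> real" where
  "zero_extend N a k = (if k \<le> N then a k else 0)"

definition log_concave_upto :: "nat \<Rightarrow> (nat \<Rightarrow> real) \<Rightarrow> bool" where
  "log_concave_upto N a \<longleftrightarrow> log_concave (zero_extend N a)"

definition unimodal_upto :: "nat \<Rightarrow> (nat \<Rightarrow> real) \<Rightarrow> bool" where
  "unimodal_upto N a \<longleftrightarrow>
     (\<exists>m\<le>N. (\<forall>i<m. a i \<le> a (i + 1)) \<and> (\<forall>i. m \<le> i \<and> i < N \<longrightarrow> a (i + 1) \<le> a i))"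

end

theory Submission
  imports Defs "HOL-Library.FuncSet"
begin

text \<open>
  The proof passes through the product formula for the generating function,
  \<open>(\<Sum>k. i\<^sub>B(n, k) q\<^sup>k) = (\<Prod>m=1..n. 1 + q + \<dots> + q\<^bsup>2m-1\<^esup>)\<close>.

  It comes from an analogue of the Lehmer code.  At position \<open>m\<close> let \<open>a < m\<close> be the number of
  earlier entries that exceed \<open>\<sigma>\<^sub>m\<close>.  The contribution of \<open>m\<close> to \<open>inv\<^sub>B\<close> is \<open>a\<close> for a positive sign
  and \<open>1 + 2 (m - 1 - a) + a = 2m - 1 - a\<close> for a negative one.  The first kind of value fills
  \<open>{0, ..., m-1}\<close>, the second \<open>{m, ..., 2m-1}\<close>, so the contribution determines both the sign and \<open>a\<close>,
  and the numbers \<open>a\<close> determine \<open>\<sigma>\<close> (\<open>lehmer_code_determines\<close>).  Thus signed permutations inject into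
  the words \<open>c\<close> with \<open>c\<^sub>m < 2m\<close>; as there are \<open>2\<^sup>n n!\<close> of each, this is a bijection
  (\<open>bij_betw_inv_code\<close>), and \<open>i\<^sub>B(n, k)\<close> counts the words with letter sum \<open>k\<close>.

  Fixing the last letter, which costs multiplication by \<open>1 + q + \<dots> + q\<^bsup>2n+1\<^esup>\<close> on generating functions,
  replaces the sequence of counts by its sums over windows of length \<open>2n + 2\<close>
  (\<open>code_count_Suc\<close>).  Such window sums preserve log-concavity
  (\<open>strongly_log_concave_window_sum\<close>), provided that log-concavity is taken in the strong form
  that excludes internal zeros.  The strong form also yields unimodality.
\<close>

section \<open>Strongly log-concave sequences\<close>

text \<open>
  This is total positivity of order two of the Toeplitz matrix of \<open>a\<close>, or equivalently
  log-concavity without internal zeros.  Log-concavity alone would not survive convolution: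
  \<open>1, 0, 0, 1\<close> is log-concave, but its sums over windows of length two, \<open>1, 1, 0, 1, 1\<close>, are
  not.  Sequences are indexed by the integers so that shifts need no boundary cases.
\<close>

definition strongly_log_concave :: "(int \<Rightarrow> real) \<Rightarrow> bool" where
  "strongly_log_concave a \<longleftrightarrow>
     (\<forall>x. 0 \<le> a x) \<and> (\<forall>x y t. x \<le> y \<longrightarrow> a x * a (y + int t) \<le> a (x + int t) * a y)"

text \<open>
  Moving the two arguments towards each other by one unit \<open>t\<close> times gives the condition for
  distance \<open>t\<close>.  If they meet before the \<open>t\<close> units are used up, the remaining claim is an equality.
\<close>

lemma strongly_log_concaveI_step:
  assumes nonneg: "\<And>x. 0 \<le> a x"
    and step: "\<And>x y. x < y \<Longrightarrow> a x * a (y + 1) \<le> a (x + 1) * a y"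
  shows "strongly_log_concave a"
proof -
  have "a x * a (y + int t) \<le> a (x + int t) * a y" if "x \<le> y" for x y t
    using that
  proof (induction t arbitrary: x)
    case (Suc t)
    show ?case
    proof (cases "x = y")
      case False
      with Suc.prems have "x < y" by simp
      have "a x * a (y + int (Suc t)) = a x * a ((y + int t) + 1)"
        by (simp add: algebra_simps)
      also have "\<dots> \<le> a (x + 1) * a (y + int t)"
        using step[of x "y + int t"] \<open>x < y\<close> by simp
      also have "\<dots> \<le> a ((x + 1) + int t) * a y"
        using Suc.IH[of "x + 1"] \<open>x < y\<close> by simp
      finally show ?thesis by (simp add: algebra_simps)
    qed simp
  qed simp
  with nonneg show ?thesis by (simp add: strongly_log_concave_def)
qed

text \<open>
  For \<open>x < y\<close> the windows ending at \<open>x\<close> and \<open>x + 1\<close> share all but one summand each, and so do those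
  ending at \<open>y\<close> and \<open>y + 1\<close>.  With \<open>M\<close> and \<open>M'\<close> the common parts, the claim becomes
  \<open>(M + a (x - K)) * (a (y + 1) + M') \<le> (a (x + 1) + M) * (M' + a (y - K))\<close>.  The product \<open>M * M'\<close>
  cancels, and each of the three remaining products on the left is dominated by one on the right,
  term by term through strong log-concavity of \<open>a\<close>.
\<close>

lemma strongly_log_concave_window_sum:
  assumes "strongly_log_concave a"
  shows "strongly_log_concave (\<lambda>z. \<Sum>s<L. a (z - int s))"
proof (cases L)
  case 0
  then show ?thesis by (simp add: strongly_log_concave_def)
next
  case (Suc K)
  have nonneg: "0 \<le> a x" for x
    using assms by (simp add: strongly_log_concave_def)
  have slc: "a x * a (y + int t) \<le> a (x + int t) * a y" if "x \<le> y" for x y t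
    using assms that by (simp add: strongly_log_concave_def)
  show ?thesis
  proof (rule strongly_log_concaveI_step)
    show "0 \<le> (\<Sum>s<L. a (z - int s))" for z
      by (simp add: sum_nonneg nonneg)
  next
    fix x y :: int
    assume "x < y"
    define M where "M = (\<Sum>s<K. a (x - int s))"
    define M' where "M' = (\<Sum>s<K. a (y - int s))"
    have last: "(\<Sum>s<L. a (z - int s)) = (\<Sum>s<K. a (z - int s)) + a (z - int K)" for z
      by (simp add: Suc)
    have first: "(\<Sum>s<L. a (z + 1 - int s)) = a (z + 1) + (\<Sum>s<K. a (z - int s))" for z
      by (simp add: Suc sum.lessThan_Suc_shift del: sum.lessThan_Suc)
    \<comment> \<open>In each comparison the two index pairs have equal sums and the pair on the left is spread
      further apart; the base points are chosen so that the shift is natural.\<close>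
    have high: "M * a (y + 1) \<le> a (x + 1) * M'"
      unfolding M_def M'_def sum_distrib_left sum_distrib_right
    proof (rule sum_mono)
      fix s
      show "a (x - int s) * a (y + 1) \<le> a (x + 1) * a (y - int s)"
        using slc[of "x - int s" "y - int s" "Suc s"] \<open>x < y\<close> by (simp add: algebra_simps)
    qed
    have low: "a (x - int K) * M' \<le> M * a (y - int K)"
      unfolding M_def M'_def sum_distrib_left sum_distrib_right
    proof (rule sum_mono)
      fix s assume "s \<in> {..<K}"
      then show "a (x - int K) * a (y - int s) \<le> a (x - int s) * a (y - int K)"
        using slc[of "x - int K" "y - int K" "K - s"] \<open>x < y\<close> by (simp add: of_nat_diff)
    qed
    have ends: "a (x - int K) * a (y + 1) \<le> a (x + 1) * a (y - int K)"
      using slc[of "x - int K" "y - int K" "Suc K"] \<open>x < y\<close> by (simp add: algebra_simps)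
    show "(\<Sum>s<L. a (x - int s)) * (\<Sum>s<L. a (y + 1 - int s))
          \<le> (\<Sum>s<L. a (x + 1 - int s)) * (\<Sum>s<L. a (y - int s))"
      using high low ends unfolding first last M_def[symmetric] M'_def[symmetric]
      by (simp add: algebra_simps)
  qed
qed

lemma strongly_log_concave_imp_log_concave_upto:
  assumes "strongly_log_concave a"
  shows "log_concave_upto N (\<lambda>k. a (int k))"
proof -
  have nonneg: "0 \<le> a x" for x
    using assms by (simp add: strongly_log_concave_def)
  have slc: "a x * a (y + int t) \<le> a (x + int t) * a y" if "x \<le> y" for x y t
    using assms that by (simp add: strongly_log_concave_def)
  have "a (int (i - 1)) * a (int (i + 1)) \<le> (a (int i))\<^sup>2" if "i > 0" for i
  proof -
    have "a (int i - 1) * a (int i + int 1) \<le> a (int i - 1 + int 1) * a (int i)"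
      using slc[of "int i - 1" "int i" 1] by simp
    then show ?thesis
      using that by (simp add: of_nat_diff power2_eq_square algebra_simps)
  qed
  then show ?thesis
    by (auto simp: log_concave_upto_def log_concave_def zero_extend_def nonneg)
qed

text \<open>
  The peak is any index \<open>m\<close> where the maximum is attained.  Left of it, strong log-concavity gives
  \<open>a i * a m \<le> a (i + 1) * a (m - 1) \<le> a (i + 1) * a m\<close>, and \<open>a m\<close> cancels unless the whole
  segment vanishes; the right side is symmetric.
\<close>

lemma strongly_log_concave_imp_unimodal_upto:
  assumes "strongly_log_concave a"
  shows "unimodal_upto N (\<lambda>k. a (int k))"
proof -
  have nonneg: "0 \<le> a x" for x
    using assms by (simp add: strongly_log_concave_def)
  have slc: "a x * a (y + int t) \<le> a (x + int t) * a y" if "x \<le> y" for x y t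
    using assms that by (simp add: strongly_log_concave_def)
  have step: "a x * a (y + 1) \<le> a (x + 1) * a y" if "x \<le> y" for x y
    using slc[OF that, of 1] by simp
  have "finite ((\<lambda>k. a (int k)) ` {..N})" "(\<lambda>k. a (int k)) ` {..N} \<noteq> {}" by auto
  then obtain m where m: "m \<le> N" and "a (int m) = Max ((\<lambda>k. a (int k)) ` {..N})"
    using Max_in by (metis (no_types, lifting) atMost_iff imageE)
  then have max: "a (int k) \<le> a (int m)" if "k \<le> N" for k
    using that by simp
  show ?thesis
  proof (cases "a (int m) = 0")
    case True
    then have "a (int k) = 0" if "k \<le> N" for k
      using max[OF that] nonneg[of "int k"] by simp
    then show ?thesis
      unfolding unimodal_upto_def by (intro exI[of _ N]) (auto simp del: of_nat_Suc simp: nonneg)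
  next
    case False
    then have pos: "0 < a (int m)" using nonneg[of "int m"] by simp
    have "a (int i) \<le> a (int (i + 1))" if "i < m" for i
    proof -
      have "a (int i) * a (int m) \<le> a (int (i + 1)) * a (int (m - 1))"
        using step[of "int i" "int (m - 1)"] that by (simp add: of_nat_diff algebra_simps)
      also have "\<dots> \<le> a (int (i + 1)) * a (int m)"
        using m by (intro mult_left_mono max nonneg) simp
      finally show ?thesis using pos by simp
    qed
    moreover have "a (int (i + 1)) \<le> a (int i)" if "m \<le> i" "i < N" for i
    proof -
      have "a (int m) * a (int (i + 1)) \<le> a (int (m + 1)) * a (int i)"
        using step[of "int m" "int i"] that by (simp add: algebra_simps)
      also have "\<dots> \<le> a (int m) * a (int i)"
        using that by (intro mult_right_mono max nonneg) simp
      finally show ?thesis using pos by simp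
    qed
    ultimately show ?thesis
      using m unfolding unimodal_upto_def by blast
  qed
qed

section \<open>Counting bounded words by their sum\<close>

definition codes :: "nat \<Rightarrow> (nat \<Rightarrow> nat) set" where
  "codes n = (\<Pi>\<^sub>E m\<in>{1..n}. {..<2 * m})"

definition code_count :: "nat \<Rightarrow> int \<Rightarrow> nat" where
  "code_count n z = card {c \<in> codes n. int (\<Sum>m=1..n. c m) = z}"

lemma finite_codes: "finite (codes n)"
  by (simp add: codes_def finite_PiE)

lemma card_codes: "card (codes n) = fact n * 2 ^ n"
proof -
  have "card (codes n) = (\<Prod>m=1..n. 2 * m)"
    by (simp add: codes_def card_PiE)
  also have "\<dots> = fact n * 2 ^ n"
    by (simp add: prod.distrib fact_prod)
  finally show ?thesis .
qed

lemma code_count_0: "code_count 0 z = (if z = 0 then 1 else 0)"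
  by (simp add: code_count_def codes_def)

text \<open>
  The summation index \<open>s\<close> is the last letter, which ranges over \<open>{..<2 * Suc n}\<close>.
\<close>

lemma code_count_Suc: "code_count (Suc n) z = (\<Sum>s<2 * Suc n. code_count n (z - int s))"
proof -
  let ?A = "\<lambda>s. {c \<in> codes n. int (\<Sum>m=1..n. c m) = z - int s}"
  let ?f = "\<lambda>(s, c). c(Suc n := s)"
  have notin: "Suc n \<notin> {1..n}" by simp
  have codes_Suc: "codes (Suc n) = ?f ` ({..<2 * Suc n} \<times> codes n)"
    unfolding codes_def by (simp add: atLeastAtMostSuc_conv PiE_insert_eq)
  have inj: "inj_on ?f ({..<2 * Suc n} \<times> codes n)"
    using inj_combinator[OF notin, of "\<lambda>m. {..<2 * m}"] by (simp add: codes_def)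
  have sum_upd: "(\<Sum>m=1..Suc n. (c(Suc n := s)) m) = s + (\<Sum>m=1..n. c m)"
    for c :: "nat \<Rightarrow> nat" and s
    by (simp add: add.commute)
  have "{c \<in> codes (Suc n). int (\<Sum>m=1..Suc n. c m) = z}
        = ?f ` {x \<in> {..<2 * Suc n} \<times> codes n. int (\<Sum>m=1..Suc n. ?f x m) = z}"
    unfolding codes_Suc by blast
  also have "{x \<in> {..<2 * Suc n} \<times> codes n. int (\<Sum>m=1..Suc n. ?f x m) = z}
             = (SIGMA s:{..<2 * Suc n}. ?A s)"
    unfolding split_beta sum_upd by auto
  finally have "{c \<in> codes (Suc n). int (\<Sum>m=1..Suc n. c m) = z} = ?f ` (SIGMA s:{..<2 * Suc n}. ?A s)" .
  moreover have "inj_on ?f (SIGMA s:{..<2 * Suc n}. ?A s)"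
    by (rule inj_on_subset[OF inj]) auto
  ultimately have "code_count (Suc n) z = card (SIGMA s:{..<2 * Suc n}. ?A s)"
    by (simp add: code_count_def card_image del: sum.cl_ivl_Suc)
  also have "\<dots> = (\<Sum>s<2 * Suc n. code_count n (z - int s))"
    by (subst card_SigmaI) (simp_all add: finite_codes code_count_def)
  finally show ?thesis .
qed

lemma strongly_log_concave_code_count: "strongly_log_concave (\<lambda>z. real (code_count n z))"
proof (induction n)
  case 0
  show ?case by (auto simp: strongly_log_concave_def code_count_0)
next
  case (Suc n)
  from strongly_log_concave_window_sum[OF this, of "2 * Suc n"] show ?case
    by (simp only: code_count_Suc of_nat_sum)
qed

section \<open>Inversion codes of signed permutations\<close>

text \<open>
  The statistic \<open>inv_signed\<close> numbers positions from the right; the code is indexed by the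
  position itself, so that its letter at \<open>m\<close> has the bound \<open>2 * m\<close>.
\<close>

definition inv_code :: "nat \<Rightarrow> (int \<Rightarrow> int) \<Rightarrow> nat \<Rightarrow> nat" where
  "inv_code n \<pi> = (\<lambda>m\<in>{1..n}. inv_signed n \<pi> (n + 1 - m))"

lemma sum_inv_code: "(\<Sum>m=1..n. inv_code n \<pi> m) = inv_B n \<pi>"
proof -
  have "inv_B n \<pi> = (\<Sum>m=1..n. inv_signed n \<pi> (n + 1 - m))"
    unfolding inv_B_def by (subst sum.atLeastAtMost_rev) simp
  also have "\<dots> = (\<Sum>m=1..n. inv_code n \<pi> m)"
    by (rule sum.cong) (simp_all add: inv_code_def)
  finally show ?thesis ..
qed

lemma card_less_add_card_greater:
  fixes \<sigma> :: "nat \<Rightarrow> nat"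
  assumes "inj_on \<sigma> {1..n}" and "m \<in> {1..n}"
  shows "card {j \<in> {1..<m}. \<sigma> j < \<sigma> m} + card {j \<in> {1..<m}. \<sigma> m < \<sigma> j} = m - 1"
proof -
  let ?L = "{j \<in> {1..<m}. \<sigma> j < \<sigma> m}" and ?G = "{j \<in> {1..<m}. \<sigma> m < \<sigma> j}"
  have "\<sigma> j < \<sigma> m \<or> \<sigma> m < \<sigma> j" if "j \<in> {1..<m}" for j
    using inj_onD[OF assms(1), of j m] assms(2) that unfolding neq_iff[symmetric] by auto
  then have union: "?L \<union> ?G = {1..<m}" by blast
  have "card (?L \<union> ?G) = card ?L + card ?G"
    by (rule card_Un_disjoint) auto
  then show ?thesis unfolding union by simp
qed

text \<open>
  The two branches take values below \<open>m\<close> and from \<open>m\<close> upwards respectively, which is what makes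
  the sign readable from the code.
\<close>

lemma inv_code_eq:
  assumes "\<pi> \<in> hyperoctahedral n" and m: "m \<in> {1..n}"
  defines "a \<equiv> card {j \<in> {1..<m}. abs_perm \<pi> m < abs_perm \<pi> j}"
  shows "inv_code n \<pi> m = (if sign_exp \<pi> m = 0 then a else 2 * m - 1 - a)"
    and "a < m"
proof -
  define b where "b = card {j \<in> {1..<m}. abs_perm \<pi> j < abs_perm \<pi> m}"
  have inj: "inj_on (abs_perm \<pi>) {1..n}"
    using hyperoctahedral_decomposition(3)[OF assms(1)] by (simp add: bij_betw_def)
  have ab: "b + a = m - 1"
    unfolding a_def b_def by (rule card_less_add_card_greater[OF inj m])
  then show "a < m" using m by auto
  have a': "card {j. 1 \<le> j \<and> j < m \<and> abs_perm \<pi> j > abs_perm \<pi> m} = a"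
    unfolding a_def by (rule arg_cong[where f = card]) auto
  have b': "card {j. 1 \<le> j \<and> j < m \<and> abs_perm \<pi> j < abs_perm \<pi> m} = b"
    unfolding b_def by (rule arg_cong[where f = card]) auto
  have "n + 1 - (n + 1 - m) = m" using m by simp
  then have "inv_code n \<pi> m = (if sign_exp \<pi> m = 0 then a else 1 + 2 * b + a)"
    using m by (simp only: inv_code_def inv_signed_def inv_perm_def Let_def restrict_apply a' b' if_True)
  then show "inv_code n \<pi> m = (if sign_exp \<pi> m = 0 then a else 2 * m - 1 - a)"
    using ab m by auto
qed

lemma inv_code_in_codes:
  assumes "\<pi> \<in> hyperoctahedral n"
  shows "inv_code n \<pi> \<in> codes n"
  unfolding codes_def
proof (rule PiE_I)
  fix m assume "m \<in> {1..n}"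
  then show "inv_code n \<pi> m \<in> {..<2 * m}"
    using inv_code_eq[OF assms, of m] by auto
qed (simp only: inv_code_def restrict_apply if_False)

text \<open>
  The last letter of the code is the number of values in the common range that exceed the last
  entry, hence it fixes that entry; after removing it, the initial segments again have a common
  range.  This is why the induction is over injections with equal ranges and not over
  permutations of \<open>{1..n}\<close>.
\<close>

lemma lehmer_code_determines:
  fixes \<sigma> \<tau> :: "nat \<Rightarrow> nat"
  assumes "inj_on \<sigma> {1..n}" "inj_on \<tau> {1..n}" "\<sigma> ` {1..n} = \<tau> ` {1..n}"
    and "\<And>m. m \<in> {1..n} \<Longrightarrow>
           card {j \<in> {1..<m}. \<sigma> m < \<sigma> j} = card {j \<in> {1..<m}. \<tau> m < \<tau> j}"
    and "p \<in> {1..n}"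
  shows "\<sigma> p = \<tau> p"
  using assms
proof (induction n)
  case (Suc n)
  define S where "S = \<sigma> ` {1..Suc n}"
  have S_\<tau>: "S = \<tau> ` {1..Suc n}" using Suc.prems(3) by (simp add: S_def)
  have rank: "card {j \<in> {1..<Suc n}. \<rho> (Suc n) < \<rho> j} = card {v \<in> S. \<rho> (Suc n) < v}"
    if "inj_on \<rho> {1..Suc n}" "S = \<rho> ` {1..Suc n}" for \<rho> :: "nat \<Rightarrow> nat"
  proof -
    have "{v \<in> S. \<rho> (Suc n) < v} = \<rho> ` {j \<in> {1..<Suc n}. \<rho> (Suc n) < \<rho> j}"
      unfolding that(2) by (auto simp: less_Suc_eq_le le_Suc_eq)
    moreover have "inj_on \<rho> {j \<in> {1..<Suc n}. \<rho> (Suc n) < \<rho> j}"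
      by (rule inj_on_subset[OF that(1)]) auto
    ultimately show ?thesis by (simp add: card_image)
  qed
  have smaller_rank: "card {v \<in> S. y < v} < card {v \<in> S. x < v}" if "x < y" "y \<in> S" for x y
  proof (rule psubset_card_mono)
    show "finite {v \<in> S. x < v}" by (simp add: S_def)
    have "y \<in> {v \<in> S. x < v}" "y \<notin> {v \<in> S. y < v}" using that by auto
    moreover have "{v \<in> S. y < v} \<subseteq> {v \<in> S. x < v}" using that by auto
    ultimately show "{v \<in> S. y < v} \<subset> {v \<in> S. x < v}" by blast
  qed
  have "card {v \<in> S. \<sigma> (Suc n) < v} = card {v \<in> S. \<tau> (Suc n) < v}"
    using Suc.prems(4)[of "Suc n"] rank[OF Suc.prems(1) S_def] rank[OF Suc.prems(2) S_\<tau>] by simp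
  moreover have "\<sigma> (Suc n) \<in> S" by (simp add: S_def)
  moreover have "\<tau> (Suc n) \<in> S" by (simp add: S_\<tau>)
  ultimately have last: "\<sigma> (Suc n) = \<tau> (Suc n)"
    using smaller_rank[of "\<sigma> (Suc n)" "\<tau> (Suc n)"] smaller_rank[of "\<tau> (Suc n)" "\<sigma> (Suc n)"]
    by (cases rule: linorder_cases[of "\<sigma> (Suc n)" "\<tau> (Suc n)"]) simp_all
  have init: "\<rho> ` {1..n} = S - {\<rho> (Suc n)}"
    if "inj_on \<rho> {1..Suc n}" "S = \<rho> ` {1..Suc n}" for \<rho> :: "nat \<Rightarrow> nat"
  proof -
    have "{1..n} = {1..Suc n} - {Suc n}" by auto
    then show ?thesis
      using inj_on_image_set_diff[OF that(1), of "{1..Suc n}" "{Suc n}"] that(2) by simp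
  qed
  show ?case
  proof (cases "p = Suc n")
    case False
    have "\<sigma> ` {1..n} = \<tau> ` {1..n}"
      using init[OF Suc.prems(1) S_def] init[OF Suc.prems(2) S_\<tau>] last by simp
    moreover have "inj_on \<sigma> {1..n}" "inj_on \<tau> {1..n}"
      using Suc.prems(1,2) by (auto intro: inj_on_subset)
    ultimately show ?thesis
      using Suc.prems(4,5) False by (intro Suc.IH) auto
  qed (simp add: last)
qed simp

lemma hyperoctahedral_eqI:
  assumes \<pi>: "\<pi> \<in> hyperoctahedral n" and \<rho>: "\<rho> \<in> hyperoctahedral n"
    and eq: "\<And>p. p \<in> {1..n} \<Longrightarrow> \<pi> (int p) = \<rho> (int p)"
  shows "\<pi> = \<rho>"
proof
  fix z
  have pos: "\<pi> z = \<rho> z" if "z \<in> {1..int n}" for z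
    using eq[of "nat z"] that by (auto simp: le_nat_iff nat_le_iff)
  consider "z \<in> {1..int n}" | "- z \<in> {1..int n}" | "z \<notin> {- int n..int n} - {0}"
    by fastforce
  then show "\<pi> z = \<rho> z"
  proof cases
    case 2
    then have "\<pi> (- (- z)) = \<rho> (- (- z))"
      using \<pi> \<rho> pos[OF 2] unfolding hyperoctahedral_def by (metis (mono_tags, lifting) mem_Collect_eq)
    then show ?thesis by simp
  next
    case 3
    then show ?thesis
      using \<pi> \<rho> by (metis (mono_tags, lifting) hyperoctahedral_def mem_Collect_eq permutes_not_in)
  qed (rule pos)
qed

lemma inj_on_inv_code: "inj_on (inv_code n) (hyperoctahedral n)"
proof (rule inj_onI)
  fix \<pi> \<rho>
  assume \<pi>: "\<pi> \<in> hyperoctahedral n" and \<rho>: "\<rho> \<in> hyperoctahedral n"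
    and eq: "inv_code n \<pi> = inv_code n \<rho>"
  let ?a = "\<lambda>\<sigma> m. card {j \<in> {1..<m}. \<sigma> m < (\<sigma> j :: nat)}"
  have both: "sign_exp \<pi> m = sign_exp \<rho> m \<and> ?a (abs_perm \<pi>) m = ?a (abs_perm \<rho>) m"
    if "m \<in> {1..n}" for m
    using inv_code_eq[OF \<pi> that] inv_code_eq[OF \<rho> that] eq
      hyperoctahedral_decomposition(2)[OF \<pi>, of m] hyperoctahedral_decomposition(2)[OF \<rho>, of m]
    by (auto split: if_splits)
  have "abs_perm \<pi> p = abs_perm \<rho> p" if "p \<in> {1..n}" for p
    by (rule lehmer_code_determines[of _ n])
      (use hyperoctahedral_decomposition(3)[OF \<pi>] hyperoctahedral_decomposition(3)[OF \<rho>] both that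
        in \<open>simp_all add: bij_betw_def\<close>)
  then show "\<pi> = \<rho>"
    using both hyperoctahedral_decomposition(1)[OF \<pi>] hyperoctahedral_decomposition(1)[OF \<rho>]
    by (intro hyperoctahedral_eqI[OF \<pi> \<rho>]) metis
qed

text \<open>
  The set \<open>R\<close> collects the positions that carry a negative sign.  These maps serve to bound the
  order of the hyperoctahedral group from below by \<open>2 ^ n * fact n\<close>.
\<close>

definition signed_perm :: "nat \<Rightarrow> (nat \<Rightarrow> nat) \<times> nat set \<Rightarrow> int \<Rightarrow> int" where
  "signed_perm n = (\<lambda>(\<sigma>, R) z.
     if z \<in> {- int n..int n} - {0}
     then sgn z * (if nat \<bar>z\<bar> \<in> R then - 1 else 1) * int (\<sigma> (nat \<bar>z\<bar>)) else z)"

lemma signed_perm_in_hyperoctahedral: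
  assumes \<sigma>: "\<sigma> permutes {1..n}"
  shows "signed_perm n (\<sigma>, R) \<in> hyperoctahedral n"
proof -
  let ?D = "{- int n..int n} - {0}"
  let ?\<pi> = "signed_perm n (\<sigma>, R)"
  have \<pi>: "?\<pi> z = sgn z * (if nat \<bar>z\<bar> \<in> R then - 1 else 1) * int (\<sigma> (nat \<bar>z\<bar>))"
    if "z \<in> ?D" for z
    using that by (simp add: signed_perm_def)
  have \<sigma>_in: "\<sigma> (nat \<bar>z\<bar>) \<in> {1..n}" if "z \<in> ?D" for z
    using permutes_in_image[OF \<sigma>, of "nat \<bar>z\<bar>"] that by auto
  have abs_\<pi>: "\<bar>?\<pi> z\<bar> = int (\<sigma> (nat \<bar>z\<bar>))" if "z \<in> ?D" for z
    using that by (simp add: \<pi> abs_mult)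
  have "inj_on ?\<pi> ?D"
  proof (rule inj_onI)
    fix y z assume y: "y \<in> ?D" and z: "z \<in> ?D" and eq: "?\<pi> y = ?\<pi> z"
    have "\<sigma> (nat \<bar>y\<bar>) = \<sigma> (nat \<bar>z\<bar>)"
      using abs_\<pi>[OF y] abs_\<pi>[OF z] eq by simp
    then have abs_eq: "nat \<bar>y\<bar> = nat \<bar>z\<bar>"
      using permutes_inj[OF \<sigma>] by (simp add: inj_eq)
    then have "sgn y = sgn z"
      using eq \<sigma>_in[OF z] unfolding \<pi>[OF y] \<pi>[OF z] abs_eq by (auto split: if_splits)
    with abs_eq show "y = z"
      by (metis abs_ge_zero eq_nat_nat_iff mult_sgn_abs)
  qed
  moreover have "?\<pi> ` ?D \<subseteq> ?D"
  proof
    fix w assume "w \<in> ?\<pi> ` ?D"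
    then obtain z where z: "z \<in> ?D" "w = ?\<pi> z" by blast
    then have "\<bar>w\<bar> \<in> {1..int n}" using abs_\<pi>[of z] \<sigma>_in[of z] by simp
    then show "w \<in> ?D" by auto
  qed
  ultimately have "bij_betw ?\<pi> ?D ?D"
    unfolding bij_betw_def using endo_inj_surj[of ?D ?\<pi>] by blast
  then have "?\<pi> permutes ?D"
    by (rule bij_imp_permutes) (simp only: signed_perm_def split if_False)
  moreover have "?\<pi> (- j) = - ?\<pi> j" if "j \<in> {1..int n}" for j
    using that by (simp add: \<pi>)
  ultimately show ?thesis by (simp add: hyperoctahedral_def)
qed

lemma inj_on_signed_perm: "inj_on (signed_perm n) ({\<sigma>. \<sigma> permutes {1..n}} \<times> Pow {1..n})"
proof (rule inj_onI, clarify)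
  fix \<sigma> \<tau> R Q
  assume \<sigma>: "\<sigma> permutes {1..n}" and \<tau>: "\<tau> permutes {1..n}"
    and R: "R \<subseteq> {1..n}" and Q: "Q \<subseteq> {1..n}"
    and eq: "signed_perm n (\<sigma>, R) = signed_perm n (\<tau>, Q)"
  have both: "\<sigma> p = \<tau> p \<and> (p \<in> R \<longleftrightarrow> p \<in> Q)" if p: "p \<in> {1..n}" for p
  proof -
    have "\<sigma> p \<in> {1..n}" "\<tau> p \<in> {1..n}"
      using permutes_in_image[OF \<sigma>, of p] permutes_in_image[OF \<tau>, of p] p by auto
    then show ?thesis
      using fun_cong[OF eq, of "int p"] p by (auto simp: signed_perm_def split: if_splits)
  qed
  have "\<sigma> p = \<tau> p" for p
    using both[of p] permutes_not_in[OF \<sigma>, of p] permutes_not_in[OF \<tau>, of p]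
    by (cases "p \<in> {1..n}") simp_all
  then show "\<sigma> = \<tau> \<and> R = Q" using both R Q by blast
qed

text \<open>
  Surjectivity is a matter of counting: the group embeds into the codes, and the pairs of a
  permutation and a set of signs, as numerous as the codes, embed into the group.
\<close>

lemma bij_betw_inv_code: "bij_betw (inv_code n) (hyperoctahedral n) (codes n)"
proof -
  let ?P = "{\<sigma>. \<sigma> permutes {1..n}} \<times> Pow {1..n}"
  have sub: "inv_code n ` hyperoctahedral n \<subseteq> codes n"
    using inv_code_in_codes by blast
  have fin: "finite (hyperoctahedral n)"
    using inj_on_finite[OF inj_on_inv_code sub finite_codes] .
  have "card (codes n) = card ?P"
    by (simp add: card_codes card_cartesian_product card_permutations card_Pow)
  also have "\<dots> \<le> card (hyperoctahedral n)"
    by (rule card_inj_on_le[OF inj_on_signed_perm _ fin]) (auto intro: signed_perm_in_hyperoctahedral)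
  also have "\<dots> = card (inv_code n ` hyperoctahedral n)"
    by (rule card_image[OF inj_on_inv_code, symmetric])
  finally have "inv_code n ` hyperoctahedral n = codes n"
    by (intro card_seteq[OF finite_codes sub])
  with inj_on_inv_code show ?thesis by (simp add: bij_betw_def)
qed

lemma mahonian_B_eq_code_count: "mahonian_B n k = code_count n (int k)"
proof -
  have "inv_code n ` {\<pi> \<in> hyperoctahedral n. inv_B n \<pi> = k}
        = {c \<in> codes n. (\<Sum>m=1..n. c m) = k}"
    unfolding bij_betw_imp_surj_on[OF bij_betw_inv_code, symmetric] sum_inv_code[symmetric] by blast
  then have "bij_betw (inv_code n) {\<pi> \<in> hyperoctahedral n. inv_B n \<pi> = k}
          {c \<in> codes n. int (\<Sum>m=1..n. c m) = int k}"
    by (intro bij_betw_subset[OF bij_betw_inv_code]) (auto simp only: of_nat_eq_iff)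
  then show ?thesis
    unfolding mahonian_B_def code_count_def by (rule bij_betw_same_card)
qed

theorem corollary5p4:
  fixes n :: nat
  assumes "n \<ge> 1"
  shows "log_concave_upto (n\<^sup>2) (\<lambda>k. real (mahonian_B n k)) \<and>
         unimodal_upto (n\<^sup>2) (\<lambda>k. real (mahonian_B n k))"
  unfolding mahonian_B_eq_code_count
  using strongly_log_concave_imp_log_concave_upto[OF strongly_log_concave_code_count]
    strongly_log_concave_imp_unimodal_upto[OF strongly_log_concave_code_count]
  by blast

end
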